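(* Let $G$ be a non-bipartite graph and $s$ a non-negative integer. Then $$\chi_f\big(G^{\frac{1}{2s+1}}\big)\le \frac{(2s+1)\chi_f(G)}{s\chi_f(G)+1}.$$
   Context: For positive integers $m\ge 2n$, the Kneser graph $\mathrm{KG}(m,n)$ has as vertices the $n$-subsets of $\{1,\dots,m\}$, two being adjacent iff they are disjoint. The fractional chromatic number is $\chi_f(G)=\inf\{\frac mn : \text{there is a homomorphism } G\to \mathrm{KG}(m,n)\}$. For a positive integer $t$, $G^{1/t}$ is the graph obtained from $G$ by replacing each edge by a path with $t$ edges. *)

theory Defs
  imports Complex_Main "Graph_Theory.Pair_Digraph"
begin

(* Finite simple graphs are pair_graphs: the arc set parcs is a finite, symmetric, irreflexive
   relation on the vertex set, an edge uv being the pair of arcs (u,v), (v,u). *)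

definition bipartite :: "'a pair_pre_digraph \<Rightarrow> bool" where
  "bipartite G \<longleftrightarrow>
    (\<exists>X Y. pverts G = X \<union> Y \<and> X \<inter> Y = {} \<and> parcs G \<subseteq> X \<times> Y \<union> Y \<times> X)"

definition graph_hom :: "'a pair_pre_digraph \<Rightarrow> 'b pair_pre_digraph \<Rightarrow> ('a \<Rightarrow> 'b) \<Rightarrow> bool" where
  "graph_hom G H f \<longleftrightarrow>
    (\<forall>u \<in> pverts G. f u \<in> pverts H) \<and> (\<forall>(u, v) \<in> parcs G. (f u, f v) \<in> parcs H)"

definition kneser :: "nat \<Rightarrow> nat \<Rightarrow> nat set pair_pre_digraph" where
  "kneser m n =
    \<lparr> pverts = {A. A \<subseteq> {1..m} \<and> card A = n},
      parcs = {(A, B). A \<subseteq> {1..m} \<and> card A = n \<and> B \<subseteq> {1..m} \<and> card B = n \<and> A \<inter> B = {}} \<rparr>"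

(* The infimum is over a nonempty set that is bounded below by 2 whenever G is a finite simple
   graph; see fractional_chromatic_set_nonempty and fractional_chromatic_number_ge_2. *)
definition fractional_chromatic_set :: "'a pair_pre_digraph \<Rightarrow> real set" where
  "fractional_chromatic_set G =
    {real m / real n | m n. 0 < n \<and> 2 * n \<le> m \<and> (\<exists>f. graph_hom G (kneser m n) f)}"

definition fractional_chromatic_number :: "'a pair_pre_digraph \<Rightarrow> real" where
  "fractional_chromatic_number G = Inf (fractional_chromatic_set G)"

(* Inner {(u, i), (v, t - i)} is the internal vertex at distance i from u and t - i from v on the
   path replacing the edge uv. The set is unordered, so both orientations of an edge yield the
   same path: path_vertex t u v i = path_vertex t v u (t - i). *)
datatype 'a subdiv_vertex = Branch 'a | Inner "('a \<times> nat) set"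

definition path_vertex :: "nat \<Rightarrow> 'a \<Rightarrow> 'a \<Rightarrow> nat \<Rightarrow> 'a subdiv_vertex" where
  "path_vertex t u v i =
    (if i = 0 then Branch u else if i = t then Branch v else Inner {(u, i), (v, t - i)})"

(* The graph G^{1/t}, for t > 0. *)
definition edge_subdivision :: "nat \<Rightarrow> 'a pair_pre_digraph \<Rightarrow> 'a subdiv_vertex pair_pre_digraph" where
  "edge_subdivision t G =
    \<lparr> pverts = Branch ` pverts G \<union> {path_vertex t u v i | u v i. (u, v) \<in> parcs G \<and> i \<le> t},
      parcs = {(path_vertex t u v i, path_vertex t u v (Suc i)) | u v i. (u, v) \<in> parcs G \<and> i < t} \<rparr>"

lemma path_vertex_swap:
  assumes "0 < t" "i \<le> t"
  shows "path_vertex t u v i = path_vertex t v u (t - i)"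
  using assms by (auto simp: path_vertex_def)

lemma path_vertex_Suc_neq:
  assumes "u \<noteq> v" "i < t"
  shows "path_vertex t u v i \<noteq> path_vertex t u v (Suc i)"
  using assms by (auto simp: path_vertex_def doubleton_eq_iff)

lemma path_vertex_internal_eq_iff:
  assumes "u \<noteq> v" "0 < i" "i < t" "j \<le> t"
  shows "path_vertex t u v i = path_vertex t x y j \<longleftrightarrow>
    (x = u \<and> y = v \<and> j = i) \<or> (x = v \<and> y = u \<and> j = t - i)"
  using assms by (auto simp: path_vertex_def doubleton_eq_iff)

lemma pair_graph_kneser:
  assumes "0 < n"
  shows "pair_graph (kneser m n)"
proof -
  have fin: "finite (pverts (kneser m n))"
    by (simp add: kneser_def)
  have sub: "parcs (kneser m n) \<subseteq> pverts (kneser m n) \<times> pverts (kneser m n)"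
    by (auto simp: kneser_def)
  then have fin': "finite (parcs (kneser m n))"
    by (rule finite_subset) (intro finite_cartesian_product fin)
  have sym: "sym (parcs (kneser m n))"
    unfolding sym_def kneser_def by (simp add: Int_commute)
  have "fst e \<noteq> snd e" if "e \<in> parcs (kneser m n)" for e
  proof
    assume eq: "fst e = snd e"
    have disj: "fst e \<inter> snd e = {}" and card: "card (fst e) = n"
      using that by (simp_all add: kneser_def case_prod_unfold)
    from disj eq have "fst e = {}" by (metis Int_absorb)
    with card assms show False by (metis card.empty less_irrefl)
  qed
  with fin fin' sym show ?thesis
    by unfold_locales (auto simp: symmetric_def dest: subsetD[OF sub])
qed

lemma pair_graph_edge_subdivision:
  assumes "pair_graph G" "0 < t"
  shows "pair_graph (edge_subdivision t G)"
proof -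
  interpret pair_graph G by fact
  have symG: "(v, u) \<in> parcs G" if "(u, v) \<in> parcs G" for u v
    using pair_sym_arcs that by (auto simp: symmetric_def dest: symD)
  let ?S = "{path_vertex t u v i | u v i. (u, v) \<in> parcs G \<and> i \<le> t}"
  have "?S \<subseteq> (\<lambda>((u, v), i). path_vertex t u v i) ` (parcs G \<times> {..t})"
  proof clarify
    fix u v i assume "(u, v) \<in> parcs G" "i \<le> t"
    then show "path_vertex t u v i \<in> (\<lambda>((u, v), i). path_vertex t u v i) ` (parcs G \<times> {..t})"
      by (intro image_eqI[of _ _ "((u, v), i)"]) auto
  qed
  then have "finite ?S"
    by (rule finite_subset) (intro finite_imageI finite_cartesian_product pair_finite_arcs finite_atMost)
  then have fin: "finite (pverts (edge_subdivision t G))"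
    using pair_finite_verts by (simp add: edge_subdivision_def)
  have sub: "parcs (edge_subdivision t G) \<subseteq> pverts (edge_subdivision t G) \<times> pverts (edge_subdivision t G)"
  proof clarify
    fix a b assume "(a, b) \<in> parcs (edge_subdivision t G)"
    then obtain u v i where "(u, v) \<in> parcs G" "i < t"
      "a = path_vertex t u v i" "b = path_vertex t u v (Suc i)"
      by (auto simp: edge_subdivision_def)
    moreover from this have "i \<le> t" "Suc i \<le> t" by simp_all
    ultimately show "a \<in> pverts (edge_subdivision t G) \<and> b \<in> pverts (edge_subdivision t G)"
      unfolding edge_subdivision_def pair_pre_digraph.select_convs by blast
  qed
  have fin': "finite (parcs (edge_subdivision t G))"
    using fin sub by (meson finite_SigmaI finite_subset)
  have "sym (parcs (edge_subdivision t G))"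
  proof (rule symI)
    fix a b assume "(a, b) \<in> parcs (edge_subdivision t G)"
    then obtain u v i where *: "(u, v) \<in> parcs G" "i < t"
      "a = path_vertex t u v i" "b = path_vertex t u v (Suc i)"
      by (auto simp: edge_subdivision_def)
    then have "b = path_vertex t v u (t - Suc i)" "a = path_vertex t v u (Suc (t - Suc i))"
      using path_vertex_swap[of t i u v] path_vertex_swap[of t "Suc i" u v] by (auto simp: Suc_diff_Suc)
    moreover have "t - Suc i < t" using * by simp
    ultimately show "(b, a) \<in> parcs (edge_subdivision t G)"
      using symG[OF *(1)] unfolding edge_subdivision_def by auto
  qed
  moreover have "fst e \<noteq> snd e" if e: "e \<in> parcs (edge_subdivision t G)" for e
  proof -
    obtain u v i where "(u, v) \<in> parcs G" "i < t"
      "e = (path_vertex t u v i, path_vertex t u v (Suc i))"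
      using e unfolding edge_subdivision_def pair_pre_digraph.select_convs by blast
    with path_vertex_Suc_neq[OF no_loops'[OF this(1)] this(2)] show ?thesis
      by simp
  qed
  ultimately show ?thesis
    using fin fin' by unfold_locales (auto simp: symmetric_def dest: subsetD[OF sub])
qed

lemma fractional_chromatic_set_nonempty:
  assumes "pair_graph G"
  shows "fractional_chromatic_set G \<noteq> {}"
proof -
  interpret pair_graph G by fact
  obtain c :: "'a \<Rightarrow> nat" and k where c: "c ` pverts G = {i. i < k}" "inj_on c (pverts G)"
    using finite_imp_inj_to_nat_seg[OF pair_finite_verts] by blast
  have lt: "c x < k" if "x \<in> pverts G" for x
    using c(1) that by blast
  have neq: "c x \<noteq> c y" if "(x, y) \<in> parcs G" for x y
    using that no_loops' wellformed' c(2) by (metis inj_onD)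
  have "{Suc (c x)} \<subseteq> {1..k + 2}" if "x \<in> pverts G" for x
    using lt[OF that] by simp
  then have "graph_hom G (kneser (k + 2) 1) (\<lambda>x. {Suc (c x)})"
    using neq by (auto simp: graph_hom_def kneser_def dest: wellformed')
  then have "real (k + 2) / real 1 \<in> fractional_chromatic_set G"
    unfolding fractional_chromatic_set_def mem_Collect_eq
    by (intro exI[of _ "k + 2"] exI[of _ "1::nat"] conjI exI[of _ "\<lambda>x. {Suc (c x)}"]) simp_all
  then show ?thesis by blast
qed

lemma fractional_chromatic_set_ge_2:
  assumes "x \<in> fractional_chromatic_set G"
  shows "2 \<le> x"
proof -
  obtain m n where "x = real m / real n" "0 < n" "2 * n \<le> m"
    using assms by (auto simp: fractional_chromatic_set_def)
  then show ?thesis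
    using of_nat_mono[of "2 * n" m, where 'a = real] by (simp add: le_divide_eq)
qed

lemma fractional_chromatic_number_ge_2:
  assumes "pair_graph G"
  shows "2 \<le> fractional_chromatic_number G"
  unfolding fractional_chromatic_number_def
  using fractional_chromatic_set_nonempty[OF assms] fractional_chromatic_set_ge_2
  by (intro cInf_greatest)

end

(* Replace every colour c of a homomorphism f from G to KG(m, n) by t = 2 s + 1 slots (c, j).
   A branch vertex u receives the s + 1 slots j >= s of each colour in f u and the s slots j < s of
   each other colour, that is s m + n slots in all. On the path replacing an edge uv, the colours in
   f u and in f v alternate between these two complementary slot sets; as t is odd, both ends come
   out right. Any other colour has to walk from {0, ..., s - 1} back to itself in t steps inside
   KG(2 s + 1, s), which it does by moving cyclic blocks of length s. So the subdivision maps to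
   KG(t m, s m + n), and t m / (s m + n) is the bound evaluated at m / n. *)

theory Submission
  imports Defs "HOL-Number_Theory.Cong"
begin

text \<open>Colours may come from any finite set, since an injective renaming keeps cardinalities
  and disjointness. Below they are pairs of a colour and a slot.\<close>

lemma graph_hom_kneserI:
  assumes "finite C"
    and verts: "\<And>x. x \<in> pverts H \<Longrightarrow> F x \<subseteq> C \<and> card (F x) = n"
    and arcs: "\<And>x y. (x, y) \<in> parcs H \<Longrightarrow> x \<in> pverts H \<and> y \<in> pverts H \<and> F x \<inter> F y = {}"
  shows "\<exists>f. graph_hom H (kneser (card C) n) f"
proof -
  obtain h where h: "bij_betw h C {1..card C}"
    using finite_same_card_bij[of C "{1..card C}"] assms(1) by auto
  have inj: "inj_on h C" and img: "h ` C = {1..card C}"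
    using h by (auto simp: bij_betw_def)
  have verts': "h ` F x \<subseteq> {1..card C} \<and> card (h ` F x) = n" if "x \<in> pverts H" for x
    using verts[OF that] inj img by (metis card_image image_mono inj_on_subset)
  have arcs': "h ` F x \<inter> h ` F y = {}" if "(x, y) \<in> parcs H" for x y
    using arcs[OF that] verts inj by (metis image_empty inj_on_image_Int)
  have "graph_hom H (kneser (card C) n) (\<lambda>x. h ` F x)"
    unfolding graph_hom_def
  proof (intro conjI ballI)
    fix x assume "x \<in> pverts H"
    then show "h ` F x \<in> pverts (kneser (card C) n)"
      using verts' unfolding kneser_def by simp
  next
    fix e assume "e \<in> parcs H"
    moreover obtain x y where "e = (x, y)" by (cases e)
    ultimately show "case e of (x, y) \<Rightarrow> (h ` F x, h ` F y) \<in> parcs (kneser (card C) n)"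
      using verts'[of x] verts'[of y] arcs[of x y] arcs'[of x y] unfolding kneser_def by simp
  qed
  then show ?thesis by blast
qed

text \<open>A map given along oriented paths descends to the subdivision: an internal vertex has
  just the two descriptions \<open>(u, v, i)\<close> and \<open>(v, u, t - i)\<close>, and
  \<open>swap\<close> makes \<open>g\<close> agree on them.\<close>

lemma subdivision_vertex_map:
  assumes "pair_graph G" "0 < t"
    and start: "\<And>u v. (u, v) \<in> parcs G \<Longrightarrow> g u v 0 = R u"
    and swap: "\<And>u v i. (u, v) \<in> parcs G \<Longrightarrow> i \<le> t \<Longrightarrow> g u v i = g v u (t - i)"
  obtains F where "\<And>u. F (Branch u) = R u"
    and "\<And>u v i. (u, v) \<in> parcs G \<Longrightarrow> i \<le> t \<Longrightarrow> F (path_vertex t u v i) = g u v i"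
proof -
  interpret pair_graph G by fact
  define inner where "inner x X \<longleftrightarrow>
      (\<exists>u v i. (u, v) \<in> parcs G \<and> 0 < i \<and> i < t \<and> x = path_vertex t u v i \<and> X = g u v i)" for x X
  define F where "F x = (case x of Branch u \<Rightarrow> R u | Inner e \<Rightarrow> SOME X. inner x X)" for x
  have "F (path_vertex t u v i) = g u v i" if uv: "(u, v) \<in> parcs G" and i: "i \<le> t" for u v i
  proof -
    consider "i = 0" | "i = t" | "0 < i" "i < t" using i by linarith
    then show ?thesis
    proof cases
      case 1
      then show ?thesis using start[OF uv] by (simp add: F_def path_vertex_def)
    next
      case 2
      \<comment> \<open>The far end is the start of the reversed arc:
        \<open>g u v t = g v u 0 = R v\<close>.\<close>
      have "(v, u) \<in> parcs G"
        using pair_sym_arcs uv by (auto simp: symmetric_def dest: symD)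
      then show ?thesis
        using 2 start swap[OF uv i] assms(2) by (simp add: F_def path_vertex_def)
    next
      case 3
      let ?x = "path_vertex t u v i"
      have "X = g u v i" if "inner ?x X" for X
        using that path_vertex_internal_eq_iff[OF no_loops'[OF uv] 3] swap[OF uv i]
        unfolding inner_def by (metis order_less_imp_le)
      moreover have "inner ?x (g u v i)"
        using uv 3 unfolding inner_def by blast
      moreover have "F ?x = (SOME X. inner ?x X)"
        using 3 by (simp add: F_def path_vertex_def)
      ultimately show ?thesis by (metis someI)
    qed
  qed
  with that[of F] show ?thesis by (simp add: F_def)
qed

text \<open>Each step shifts the block by its own length \<open>s\<close>, so a block starts where
  the previous one ends; after \<open>2 * s + 1\<close> steps the total shift is a multiple of the
  modulus and the walk closes.\<close>

definition cyclic_block :: "nat \<Rightarrow> nat \<Rightarrow> nat set" where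
  "cyclic_block s i = (\<lambda>j. (i * s + j) mod (2 * s + 1)) ` {..<s}"

lemma inj_on_add_mod: "inj_on (\<lambda>j. (a + j) mod t) {..<t}" for a t :: nat
proof (rule inj_onI)
  fix x y assume xy: "x \<in> {..<t}" "y \<in> {..<t}" and "(a + x) mod t = (a + y) mod t"
  then have "[x = y] (mod t)"
    unfolding cong_def[symmetric] by (simp only: cong_add_lcancel_nat)
  with xy show "x = y" by (simp add: cong_def)
qed

lemma card_cyclic_block: "card (cyclic_block s i) = s"
proof -
  have "inj_on (\<lambda>j. (i * s + j) mod (2 * s + 1)) {..<s}"
    by (rule inj_on_subset[OF inj_on_add_mod]) auto
  then show ?thesis
    unfolding cyclic_block_def by (simp add: card_image)
qed

lemma cyclic_block_subset: "cyclic_block s i \<subseteq> {..<2 * s + 1}"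
  unfolding cyclic_block_def by auto

text \<open>Two successive blocks together come from \<open>2 * s\<close> consecutive integers,
  fewer than the modulus, so all their residues are distinct.\<close>

lemma cyclic_block_disjoint: "cyclic_block s i \<inter> cyclic_block s (Suc i) = {}"
proof -
  let ?r = "\<lambda>j. (i * s + j) mod (2 * s + 1)"
  have "cyclic_block s (Suc i) = ?r ` (\<lambda>j. s + j) ` {..<s}"
    unfolding cyclic_block_def image_image by (simp add: algebra_simps)
  moreover have "?r ` {..<s} \<inter> ?r ` (\<lambda>j. s + j) ` {..<s}
      = ?r ` ({..<s} \<inter> (\<lambda>j. s + j) ` {..<s})"
    by (rule inj_on_image_Int[OF inj_on_add_mod, symmetric]) auto
  moreover have "{..<s} \<inter> (\<lambda>j. s + j) ` {..<s} = {}" by auto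
  ultimately show ?thesis by (simp add: cyclic_block_def)
qed

lemma cyclic_block_0: "cyclic_block s 0 = {..<s}"
  by (simp add: cyclic_block_def)

lemma cyclic_block_last: "cyclic_block s (2 * s + 1) = {..<s}"
proof -
  have "((2 * s + 1) * s + j) mod (2 * s + 1) = j mod (2 * s + 1)" for j
    by (rule mod_mult_self4)
  then show ?thesis unfolding cyclic_block_def by simp
qed

text \<open>\<open>A\<close> and \<open>B\<close> are meant as the colour sets of the two ends of an
  edge, and \<open>i\<close> as the distance from the \<open>A\<close> end.\<close>

definition slots :: "nat \<Rightarrow> 'c set \<Rightarrow> 'c set \<Rightarrow> nat \<Rightarrow> 'c \<Rightarrow> nat set" where
  "slots s A B i c =
    (if c \<in> (if even i then A else B) then {s..<2 * s + 1}
     else if c \<in> A \<union> B then {..<s} else cyclic_block s i)"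

lemma card_slots: "card (slots s A B i c) = s + (if c \<in> (if even i then A else B) then 1 else 0)"
  by (simp add: slots_def card_cyclic_block)

lemma slots_subset: "slots s A B i c \<subseteq> {..<2 * s + 1}"
  using cyclic_block_subset by (auto simp: slots_def)

text \<open>A colour in \<open>A \<union> B\<close> switches between the lower and the upper slots
  at each step. If \<open>A\<close> and \<open>B\<close> met, a common colour would keep the upper
  ones.\<close>

lemma slots_disjoint: "A \<inter> B = {} \<Longrightarrow> slots s A B i c \<inter> slots s A B (Suc i) c = {}"
  using cyclic_block_disjoint[of s i] by (auto simp: slots_def)

text \<open>The right side is free of \<open>B\<close>, so all paths leaving a branch vertex agree
  there.\<close>

lemma slots_first: "slots s A B 0 = (\<lambda>c. if c \<in> A then {s..<2 * s + 1} else {..<s})"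
  by (rule ext) (simp add: slots_def cyclic_block_0)

lemma slots_last: "slots s A B (2 * s + 1) = (\<lambda>c. if c \<in> B then {s..<2 * s + 1} else {..<s})"
  using cyclic_block_last[of s] by (intro ext) (simp add: slots_def)

text \<open>Each colour contributes \<open>s\<close> slots, and each of the \<open>n\<close> colours
  holding the upper slots contributes one more.\<close>

lemma card_Sigma_slots:
  assumes "finite C" "A \<subseteq> C" "B \<subseteq> C" "card A = n" "card B = n"
  shows "card (Sigma C (slots s A B i)) = s * card C + n"
proof -
  let ?D = "if even i then A else B"
  have D: "C \<inter> ?D = ?D" "card ?D = n" using assms by auto
  have "card (Sigma C (slots s A B i)) = (\<Sum>c\<in>C. card (slots s A B i c))"
    using assms(1) by (intro card_SigmaI ballI finite_subset[OF slots_subset]) simp_all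
  also have "\<dots> = s * card C + (\<Sum>c\<in>C. if c \<in> ?D then 1 else 0)"
    by (simp only: card_slots sum.distrib sum_constant mult.commute of_nat_id)
  also have "(\<Sum>c\<in>C. if c \<in> ?D then 1 else 0) = card (C \<inter> ?D)"
    using assms(1) by (subst sum.inter_restrict[symmetric]) simp_all
  finally show ?thesis using D by simp
qed

lemma subdivision_hom_kneser:
  assumes "pair_graph G" "0 < n" and f: "graph_hom G (kneser m n) f"
  shows "\<exists>h. graph_hom (edge_subdivision (2 * s + 1) G) (kneser ((2 * s + 1) * m) (s * m + n)) h"
proof -
  interpret pair_graph G by fact
  let ?t = "2 * s + 1"
  let ?H = "edge_subdivision ?t G"
  define P where "P A B i = Sigma {1..m} (slots s A B i)" for A B i
  \<comment> \<open>At step 0 the value depends on the first colour set alone, so \<open>f u\<close>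
    serves as a placeholder for the second.\<close>
  define R where "R u = P (f u) (f u) 0" for u
  \<comment> \<open>The cyclic walk is not symmetric under reversal, so every edge needs an orientation.\<close>
  define g where "g u v i = (if Min (f u) < Min (f v) then P (f u) (f v) i
      else P (f v) (f u) (?t - i))" for u v i
  have fv: "f u \<subseteq> {1..m}" "card (f u) = n" if "u \<in> pverts G" for u
    using f that by (auto simp: graph_hom_def kneser_def)
  have fa: "f u \<inter> f v = {}" if "(u, v) \<in> parcs G" for u v
    using f that by (auto simp: graph_hom_def kneser_def)
  \<comment> \<open>As \<open>n\<close> is positive, the colour sets are nonempty and disjoint ones
    have distinct minima; comparing minima thus orients every edge.\<close>
  have Min_neq: "Min (f u) \<noteq> Min (f v)" if "(u, v) \<in> parcs G" for u v
  proof -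
    have "Min (f w) \<in> f w" if "w \<in> pverts G" for w
      using fv[OF that] assms(2) by (intro Min_in) (auto intro: card_ge_0_finite)
    then show ?thesis using wellformed'[OF that] fa[OF that] by force
  qed
  have P_first: "P A B 0 = P A A 0" and P_last: "P A B ?t = P B B 0" for A B
    by (simp_all only: P_def slots_first slots_last)
  have g_start: "g u v 0 = R u" for u v
    unfolding g_def R_def using P_first P_last by simp
  have g_swap: "g u v i = g v u (?t - i)" if "(u, v) \<in> parcs G" "i \<le> ?t" for u v i
    using Min_neq[OF that(1)] that(2) by (auto simp: g_def)
  obtain F where FB: "\<And>u. F (Branch u) = R u"
    and Fp: "\<And>u v i. (u, v) \<in> parcs G \<Longrightarrow> i \<le> ?t \<Longrightarrow> F (path_vertex ?t u v i) = g u v i"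
  proof (rule subdivision_vertex_map[of G ?t g R])
    show "pair_graph G" by fact
    show "0 < ?t" by simp
  qed (rule g_start, erule (1) g_swap, blast)
  have P: "P (f u) (f v) i \<subseteq> {1..m} \<times> {..<?t} \<and> card (P (f u) (f v) i) = s * m + n"
    if "u \<in> pverts G" "v \<in> pverts G" for u v i
    using card_Sigma_slots[of "{1..m}" "f u" "f v" n s i] fv that slots_subset[of s "f u" "f v" i]
    unfolding P_def by fastforce
  have g: "g u v i \<subseteq> {1..m} \<times> {..<?t} \<and> card (g u v i) = s * m + n" if "(u, v) \<in> parcs G" for u v i
    using P wellformed'[OF that] by (simp add: g_def)
  have P_disj: "P A B i \<inter> P A B (Suc i) = {}" if "A \<inter> B = {}" for A B i
    using slots_disjoint[OF that] unfolding P_def by blast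
  have g_disj: "g u v i \<inter> g u v (Suc i) = {}" if "(u, v) \<in> parcs G" "i < ?t" for u v i
  proof -
    \<comment> \<open>On a path read backwards, the step from \<open>i\<close> to
      \<open>Suc i\<close> is the step starting at \<open>?t - Suc i\<close>, traversed in
      reverse.\<close>
    have "?t - i = Suc (?t - Suc i)" using that(2) by simp
    then show ?thesis
      using P_disj[of "f u" "f v" i] P_disj[of "f v" "f u" "?t - Suc i"] fa[OF that(1)]
      unfolding g_def by (auto simp: Int_commute)
  qed
  interpret H: pair_graph ?H
    using pair_graph_edge_subdivision[OF assms(1)] by simp
  have "F x \<subseteq> {1..m} \<times> {..<?t} \<and> card (F x) = s * m + n" if "x \<in> pverts ?H" for x
  proof -
    from that consider u where "u \<in> pverts G" "x = Branch u"
      | u v i where "(u, v) \<in> parcs G" "i \<le> ?t" "x = path_vertex ?t u v i"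
      unfolding edge_subdivision_def by auto
    then show ?thesis
      by cases (use FB P Fp g in \<open>simp_all add: R_def\<close>)
  qed
  moreover have "x \<in> pverts ?H \<and> y \<in> pverts ?H \<and> F x \<inter> F y = {}" if "(x, y) \<in> parcs ?H" for x y
  proof -
    obtain u v i where "(u, v) \<in> parcs G" "i < ?t"
      "x = path_vertex ?t u v i" "y = path_vertex ?t u v (Suc i)"
      using \<open>(x, y) \<in> parcs ?H\<close> unfolding edge_subdivision_def pair_pre_digraph.select_convs by blast
    then show ?thesis
      using H.wellformed'[OF that] g_disj Fp[of u v i] Fp[of u v "Suc i"] by simp
  qed
  ultimately have "\<exists>h. graph_hom ?H (kneser (card ({1..m} \<times> {..<?t})) (s * m + n)) h"
    by (intro graph_hom_kneserI[where F = F]) simp_all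
  moreover have "card ({1..m} \<times> {..<?t}) = ?t * m"
    by (simp add: card_cartesian_product)
  ultimately show ?thesis by (simp only:)
qed

lemma fractional_chromatic_set_subdivision:
  assumes "pair_graph G" "x \<in> fractional_chromatic_set G"
  shows "(2 * real s + 1) * x / (real s * x + 1)
    \<in> fractional_chromatic_set (edge_subdivision (2 * s + 1) G)"
proof -
  obtain m n f where x: "x = real m / real n" and n: "0 < n" "2 * n \<le> m"
    and f: "graph_hom G (kneser m n) f"
    using assms(2) by (auto simp: fractional_chromatic_set_def)
  have "real s * x + 1 = real (s * m + n) / real n"
    using n(1) by (simp add: x add_divide_distrib)
  then have "(2 * real s + 1) * x / (real s * x + 1) = real ((2 * s + 1) * m) / real (s * m + n)"
    using n(1) by (simp add: x algebra_simps)
  \<comment> \<open>The second inequality is \<open>2 * n \<le> m\<close> after cancelling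
    \<open>2 * s * m\<close>.\<close>
  moreover have "0 < s * m + n" "2 * (s * m + n) \<le> (2 * s + 1) * m"
    using n by (simp_all add: algebra_simps)
  ultimately show ?thesis
    using subdivision_hom_kneser[OF assms(1) n(1) f, of s]
    unfolding fractional_chromatic_set_def by blast
qed

theorem theorem3:
  fixes G :: "'a pair_pre_digraph" and s :: nat
  assumes "pair_graph G"
    and "\<not> bipartite G"
  shows "fractional_chromatic_number (edge_subdivision (2 * s + 1) G)
    \<le> (2 * real s + 1) * fractional_chromatic_number G
        / (real s * fractional_chromatic_number G + 1)"
proof -
  let ?H = "edge_subdivision (2 * s + 1) G"
  define y where "y = fractional_chromatic_number ?H"
  define z where "z = fractional_chromatic_number G"
  define t where "t = 2 * real s + 1"
  have y2: "2 \<le> y"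
    unfolding y_def using assms(1)
    by (intro fractional_chromatic_number_ge_2 pair_graph_edge_subdivision) simp_all
  have z2: "2 \<le> z"
    unfolding z_def using assms(1) by (rule fractional_chromatic_number_ge_2)
  \<comment> \<open>With \<open>y\<close> fixed, this form of the bound is linear in
    \<open>x\<close>, so the infimum over \<open>x\<close> can be taken without a continuity
    argument.\<close>
  have bound: "y \<le> x * (t - y * s)" if x: "x \<in> fractional_chromatic_set G" for x
  proof -
    have "2 \<le> x" using x by (rule fractional_chromatic_set_ge_2)
    then have pos: "0 < s * x + 1" by (simp add: add_nonneg_pos)
    have "y \<le> t * x / (s * x + 1)"
      unfolding y_def t_def fractional_chromatic_number_def
      using fractional_chromatic_set_subdivision[OF assms(1) x] fractional_chromatic_set_ge_2
      by (intro cInf_lower bdd_belowI)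
    with pos show ?thesis by (simp add: field_simps)
  qed
  \<comment> \<open>One member settles the sign: \<open>y > 0\<close> forces
    \<open>x * (t - y * s) > 0\<close>, hence \<open>t - y * s > 0\<close>, which allows
    division.\<close>
  obtain x where "x \<in> fractional_chromatic_set G"
    using fractional_chromatic_set_nonempty[OF assms(1)] by blast
  then have "0 < x * (t - y * s)" "0 < x"
    using bound fractional_chromatic_set_ge_2 y2 by fastforce+
  then have pos: "0 < t - y * s" by (simp add: zero_less_mult_iff)
  \<comment> \<open>The left side is a lower bound of the whole set, hence at most its infimum
    \<open>z\<close>; undoing the rearrangement gives the claim.\<close>
  then have "y / (t - y * s) \<le> z"
    unfolding z_def fractional_chromatic_number_def
    using fractional_chromatic_set_nonempty[OF assms(1)] bound
    by (intro cInf_greatest) (simp_all add: divide_le_eq)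
  then have "y * (s * z + 1) \<le> t * z"
    using pos by (simp add: divide_le_eq algebra_simps)
  moreover have "0 < s * z + 1" using z2 by (simp add: add_nonneg_pos)
  ultimately show ?thesis
    unfolding y_def[symmetric] z_def[symmetric] t_def[symmetric] by (simp add: le_divide_eq)
qed

end
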